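(* Let $F:\mathcal X\to\mathcal E$ be strictly differentiable at $x\in\mathcal X$, let the vector back-transport $V_{y(x)}$ be consistent with the connection map $Q$ at $F(x)$, and let $Q_{F(x)}\circ F'(x):T_x\mathcal X\to E_{y(x)}$ be continuously invertible, with Newton direction $\delta x\neq0$. Let $0<\Theta_{des}<\Theta_{acc}$. Then there exists $\widehat\alpha>0$ such that $$\theta_{R_x(\alpha\delta x)}(x)\le\Theta_{acc}\qquad\text{for all }\alpha\in(0,1]\text{ with }\alpha\le\widehat\alpha .$$ Moreover, the inner loop of the damping strategy terminates after finitely many iterations: for every initial $\alpha_0\in(0,1]$, the back-tracking iteration $$\alpha_{j+1}=\min\Big(1,\frac{\alpha_j\,\Theta_{des}}{\theta_{R_x(\alpha_j\delta x)}(x)}\Big),$$ which is stopped as soon as $\theta_{R_x(\alpha_j\delta x)}(x)\le\Theta_{acc}$, stops after finitely many steps.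
   Context: **Manifolds and bundles.** $\mathcal X,\mathcal Y$ are $C^1$-Banach manifolds; $p:\mathcal E\to\mathcal Y$ is a $C^1$ vector bundle with fibres $E_y=p^{-1}(y)$ and local trivializations $\tau:p^{-1}(U)\to U\times\mathbb E$, $e\mapsto(p(e),\tau_{p(e)}e)$, with $\mathbb E$ a Banach space and $\tau_y\in L(E_y,\mathbb E)$ isomorphisms. Put $y(x):=p(F(x))$. Each $T_x\mathcal X$ carries a norm $\|\cdot\|_x$ equivalent to the norm of the model space. **Strict differentiability.** $F$ is strictly differentiable at $x_0$ with derivative $F'(x_0)\in L(T_{x_0}\mathcal X,T_{F(x_0)}\mathcal E)$ if in all chart representations $F_{\psi,\phi}=\psi\circ F\circ\phi^{-1}$, with $\xi_0=\phi(x_0)$, for every $\varepsilon>0$ there is a neighborhood $U_\varepsilon$ of $\xi_0$ with $\|(F_{\psi,\phi})'(\xi_0)(\xi-\eta)-(F_{\psi,\phi}(\xi)-F_{\psi,\phi}(\eta))\|<\varepsilon\|\xi-\eta\|$ for all $\xi\ne\eta$ in $U_\varepsilon$, where $(F_{\psi,\phi})'(\xi_0)$ represents $F'(x_0)$. **Connection map.** $Q$ assigns to every $e\in\mathcal E$ a continuous linear $Q_e:T_e\mathcal E\to E_{p(e)}$ with $Q_e\kappa_e=Id$, where $\kappa_ew=\frac d{dt}(e+tw)|_{t=0}$ for $w\in E_{p(e)}$. **Vector back-transport.** $V_y$ assigns to each $\hat y\in\mathcal Y$ an invertible $V_y(\hat y)\in L(E_{\hat y},E_y)$ with $V_y(y)=Id_{E_y}$,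 and is continuously differentiable, i.e. in local trivializations $\hat y\mapsto\tau_yV_y(\hat y)\tau_{\hat y}^{-1}\in L(\mathbb E,\mathbb E)$ is $C^1$. Put $\langle V_y\rangle:\mathcal E\to E_y$, $\langle V_y\rangle(e)=V_y(p(e))e$. $V_y$ is consistent with $Q$ at $e\in E_y$ if $Q_e=\langle V_y\rangle'(e)$. **Retraction.** $R:T\mathcal X\to\mathcal X$ is a $C^1$-retraction: $C^1$ in natural tangent bundle charts, and $R_x:=R|_{T_x\mathcal X}$ satisfies $R_x(0_x)=x$, $R_x'(0_x)=Id_{T_x\mathcal X}$. **Damping quantities.** The Newton direction $\delta x\in T_x\mathcal X$ solves $Q_{F(x)}\circ F'(x)\delta x+F(x)=0$. For $\alpha\in(0,1]$ let $x_+=R_x(\alpha\delta x)$ and let $\overline{\delta x_+^\alpha}\in T_x\mathcal X$ be the simplified Newton direction, the solution of $$Q_{F(x)}\circ F'(x)\,\overline{\delta x_+^\alpha}+V_{y(x)}(y(x_+))F(x_+)-(1-\alpha)F(x)=0 .$$ Then $\theta_{R_x(\alpha\delta x)}(x):=\|\overline{\delta x_+^\alpha}\|_x/\|\alpha\,\delta x\|_x$. *)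

theory Defs
  imports "HOL-Analysis.Analysis" "HOL-Library.Function_Algebras"
begin

section \<open>\<open>C\<^sup>1\<close> Banach manifolds\<close>

text \<open>A manifold is a topological space (all of a type) with an atlas; a chart is its domain
  together with the chart map, whose values outside the domain are irrelevant. Hausdorffness is
  not required.\<close>

type_synonym ('p, 'b) chart = "'p set \<times> ('p \<Rightarrow> 'b)"

definition C1_on ::
  "('a::real_normed_vector \<Rightarrow> 'b::real_normed_vector) \<Rightarrow> 'a set \<Rightarrow> bool" where
  "C1_on f S \<longleftrightarrow> open S \<and>
     (\<exists>f' :: 'a \<Rightarrow> 'a \<Rightarrow>\<^sub>L 'b.
        (\<forall>\<xi>\<in>S. (f has_derivative blinfun_apply (f' \<xi>)) (at \<xi>)) \<and> continuous_on S f')"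

definition C1_manifold :: "('p::topological_space, 'b::banach) chart set \<Rightarrow> bool" where
  "C1_manifold \<A> \<longleftrightarrow>
     (\<Union>c\<in>\<A>. fst c) = UNIV \<and>
     (\<forall>(U, \<phi>)\<in>\<A>. open U \<and> open (\<phi> ` U) \<and> homeomorphism U (\<phi> ` U) \<phi> (inv_into U \<phi>)) \<and>
     (\<forall>(U, \<phi>)\<in>\<A>. \<forall>(W, \<psi>)\<in>\<A>. C1_on (\<psi> \<circ> inv_into U \<phi>) (\<phi> ` (U \<inter> W)))"

text \<open>\<open>C\<^sup>1\<close> maps on an open subset \<open>S\<close> of a manifold. Openness of all sets
  \<open>\<phi> ` (U \<inter> S \<inter> f -` W)\<close>, contained in \<^const>\<open>C1_on\<close>, makes \<open>f\<close> continuous.\<close>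

definition C1_map ::
  "('p::topological_space, 'b::banach) chart set \<Rightarrow> ('q::topological_space, 'c::banach) chart set
     \<Rightarrow> 'p set \<Rightarrow> ('p \<Rightarrow> 'q) \<Rightarrow> bool" where
  "C1_map \<A> \<B> S f \<longleftrightarrow> open S \<and>
     (\<forall>(U, \<phi>)\<in>\<A>. \<forall>(W, \<psi>)\<in>\<B>. C1_on (\<psi> \<circ> f \<circ> inv_into U \<phi>) (\<phi> ` (U \<inter> S \<inter> f -` W)))"

definition prod_atlas :: "('p, 'b) chart set \<Rightarrow> ('q, 'c) chart set \<Rightarrow> ('p \<times> 'q, 'b \<times> 'c) chart set"
  where "prod_atlas \<A> \<B> = (\<lambda>((U, \<phi>), (W, \<psi>)). (U \<times> W, map_prod \<phi> \<psi>)) ` (\<A> \<times> \<B>)"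

text \<open>Operator-valued maps on an open subset \<open>S\<close> of a manifold, \<open>C\<^sup>1\<close> with respect to the
  operator norm.\<close>

definition C1_operator_map ::
  "('p::topological_space, 'b::banach) chart set \<Rightarrow> 'p set
     \<Rightarrow> ('p \<Rightarrow> 'c::real_normed_vector \<Rightarrow> 'd::real_normed_vector) \<Rightarrow> bool" where
  "C1_operator_map \<A> S T \<longleftrightarrow> (\<forall>y\<in>S. bounded_linear (T y)) \<and>
     (\<forall>(U, \<phi>)\<in>\<A>. C1_on (\<lambda>\<eta>. Blinfun (T (inv_into U \<phi> \<eta>))) (\<phi> ` (U \<inter> S)))"


section \<open>Tangent spaces\<close>

text \<open>A tangent vector at \<open>x\<close>, i.e. an equivalence class of pairs (chart at \<open>x\<close>, vector), is
  encoded by the family \<open>v\<close> of all its representatives: \<open>v c\<close> is the representative in the chart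
  \<open>c\<close> at \<open>x\<close>, and representatives are related by the derivatives of the chart transitions. The
  entries of \<open>v\<close> at everything that is not a chart at \<open>x\<close> are normalised to \<open>0\<close>. The vector space
  operations are pointwise.\<close>

instantiation "fun" :: (type, real_vector) real_vector
begin
definition scaleR_fun_def: "r *\<^sub>R f = (\<lambda>a. r *\<^sub>R f a)"
instance
  by standard (auto simp: scaleR_fun_def fun_eq_iff scaleR_add_left scaleR_add_right)
end

type_synonym ('p, 'b) tvec = "('p, 'b) chart \<Rightarrow> 'b"

definition charts_at :: "('p, 'b) chart set \<Rightarrow> 'p \<Rightarrow> ('p, 'b) chart set" where
  "charts_at \<A> x = {c \<in> \<A>. x \<in> fst c}"

definition tangent_space ::
  "('p, 'b::real_normed_vector) chart set \<Rightarrow> 'p \<Rightarrow> ('p, 'b) tvec set" where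
  "tangent_space \<A> x =
     {v. (\<forall>(U, \<phi>)\<in>charts_at \<A> x. \<forall>(W, \<psi>)\<in>charts_at \<A> x.
            v (W, \<psi>) = frechet_derivative (\<psi> \<circ> inv_into U \<phi>) (at (\<phi> x)) (v (U, \<phi>))) \<and>
         (\<forall>c. c \<notin> charts_at \<A> x \<longrightarrow> v c = 0)}"

text \<open>The tangent vector at \<open>x\<close> whose representative in the chart \<open>c\<close> is \<open>u\<close>, i.e. the inverse of
  the chart differential \<open>v \<mapsto> v c\<close>, which is a bijection by \<open>bij_betw_tangent_coord\<close> below.\<close>

definition tvec_of ::
  "('p, 'b::real_normed_vector) chart set \<Rightarrow> 'p \<Rightarrow> ('p, 'b) chart \<Rightarrow> 'b \<Rightarrow> ('p, 'b) tvec" where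
  "tvec_of \<A> x c u = inv_into (tangent_space \<A> x) (\<lambda>v. v c) u"

definition velocity ::
  "('p, 'b::real_normed_vector) chart set \<Rightarrow> (real \<Rightarrow> 'p) \<Rightarrow> real \<Rightarrow> ('p, 'b) tvec" where
  "velocity \<A> \<gamma> t =
     (\<lambda>c. if c \<in> charts_at \<A> (\<gamma> t) then vector_derivative (snd c \<circ> \<gamma>) (at t) else 0)"

lemma C1_on_frechet:
  assumes "C1_on f S" "\<xi> \<in> S"
  shows "(f has_derivative frechet_derivative f (at \<xi>)) (at \<xi>)"
  using assms unfolding C1_on_def differentiable_def
  by (metis differentiable_def frechet_derivative_works)

lemma bij_betw_tangent_coord:
  assumes A: "C1_manifold \<A>" and c: "c \<in> charts_at \<A> x"
  shows "bij_betw (\<lambda>v. v c) (tangent_space \<A> x) UNIV"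
proof -
  obtain U \<phi> where cU: "c = (U, \<phi>)" by (cases c)
  have inj: "inj_on (\<lambda>v. v c) (tangent_space \<A> x)"
  proof (intro inj_onI ext)
    fix v w d
    assume v: "v \<in> tangent_space \<A> x" and w: "w \<in> tangent_space \<A> x" and eq: "v c = w c"
    show "v d = w d"
    proof (cases "d \<in> charts_at \<A> x")
      case True
      obtain W \<psi> where "d = (W, \<psi>)" by (cases d)
      with v w eq c cU True show ?thesis
        unfolding tangent_space_def by fastforce
    next
      case False
      with v w show ?thesis unfolding tangent_space_def by (cases d) auto
    qed
  qed
  define D where
    "D c d = frechet_derivative (snd d \<circ> inv_into (fst c) (snd c)) (at (snd c x))"
    for c d :: "('a, 'b) chart"
  have inv: "inv_into (fst c) (snd c) (snd c y) = y" if "c \<in> \<A>" "y \<in> fst c" for c y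
    using A that unfolding C1_manifold_def homeomorphism_def by (cases c) fastforce
  have trans: "C1_on (snd d \<circ> inv_into (fst c) (snd c)) (snd c ` (fst c \<inter> fst d))"
    if "c \<in> charts_at \<A> x" "d \<in> charts_at \<A> x" for c d
    using A that unfolding C1_manifold_def charts_at_def by (cases c, cases d) fastforce
  have at: "snd c x \<in> snd c ` (fst c \<inter> fst d)"
    if "c \<in> charts_at \<A> x" "d \<in> charts_at \<A> x" for c d
    using that by (auto simp: charts_at_def)
  have deriv: "(snd d \<circ> inv_into (fst c) (snd c) has_derivative D c d) (at (snd c x))"
    if "c \<in> charts_at \<A> x" "d \<in> charts_at \<A> x" for c d
    unfolding D_def by (rule C1_on_frechet[OF trans[OF that] at[OF that]])
  have chain: "D d e (D c d u) = D c e u"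
    if cde: "c \<in> charts_at \<A> x" "d \<in> charts_at \<A> x" "e \<in> charts_at \<A> x" for c d e u
  proof -
    let ?S = "snd c ` (fst c \<inter> fst d)"
    have S: "open ?S" "snd c x \<in> ?S"
      using trans[OF cde(1,2)] at[OF cde(1,2)] unfolding C1_on_def by auto
    have "(snd d \<circ> inv_into (fst c) (snd c)) (snd c x) = snd d x"
      using cde inv by (auto simp: charts_at_def)
    then have "((snd e \<circ> inv_into (fst d) (snd d)) \<circ> (snd d \<circ> inv_into (fst c) (snd c))
        has_derivative D d e \<circ> D c d) (at (snd c x))"
      using diff_chain_at[OF deriv[OF cde(1,2)]] deriv[OF cde(2,3)] by metis
    then have "(snd e \<circ> inv_into (fst c) (snd c) has_derivative D d e \<circ> D c d) (at (snd c x))"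
      by (rule has_derivative_transform_within_open[OF _ S])
        (use cde inv in \<open>auto simp: charts_at_def\<close>)
    then have "D d e \<circ> D c d = D c e"
      using deriv[OF cde(1,3)] has_derivative_unique by blast
    then show ?thesis by (metis comp_apply)
  qed
  have id: "D c c u = u" for u
  proof -
    have S: "open (snd c ` fst c)" "snd c x \<in> snd c ` fst c"
      using trans[OF c c] at[OF c c] unfolding C1_on_def by auto
    have "(snd c \<circ> inv_into (fst c) (snd c) has_derivative (\<lambda>u. u)) (at (snd c x))"
      by (rule has_derivative_transform_within_open[OF has_derivative_ident S])
        (auto simp: f_inv_into_f)
    then show ?thesis using deriv[OF c c] has_derivative_unique by metis
  qed
  have "u \<in> (\<lambda>v. v c) ` tangent_space \<A> x" for u
  proof -
    let ?v = "\<lambda>d. if d \<in> charts_at \<A> x then D c d u else 0"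
    have 1: "?v c = u" using c id by simp
    have 2: "?v \<in> tangent_space \<A> x"
      using chain[OF c] unfolding tangent_space_def D_def by (auto split: prod.splits)
    show ?thesis by (rule image_eqI[of _ "\<lambda>v. v c", OF 1[symmetric] 2])
  qed
  then have "(\<lambda>v. v c) ` tangent_space \<A> x = UNIV" by blast
  with inj show ?thesis unfolding bij_betw_def by (rule conjI)
qed


section \<open>Continuous linear maps\<close>

text \<open>Tangent spaces and fibres of vector bundles are Banachable spaces: sets \<open>V\<close> with a family
  \<open>\<C>\<close> of coordinate isomorphisms onto a Banach space that are related by bounded linear
  isomorphisms. Continuity and linearity of maps are those of their coordinate
  representations.\<close>

definition cont_linear ::
  "'v set \<Rightarrow> ('v \<Rightarrow> 'b::real_normed_vector) set \<Rightarrow> 'w set \<Rightarrow> ('w \<Rightarrow> 'c::real_normed_vector) set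
     \<Rightarrow> ('v \<Rightarrow> 'w) \<Rightarrow> bool" where
  "cont_linear V \<C> W \<D> T \<longleftrightarrow> T ` V \<subseteq> W \<and>
     (\<forall>a\<in>\<C>. \<forall>b\<in>\<D>. \<exists>L. bounded_linear L \<and> (\<forall>v\<in>V. b (T v) = L (a v)))"

definition cont_invertible ::
  "'v set \<Rightarrow> ('v \<Rightarrow> 'b::real_normed_vector) set \<Rightarrow> 'w set \<Rightarrow> ('w \<Rightarrow> 'c::real_normed_vector) set
     \<Rightarrow> ('v \<Rightarrow> 'w) \<Rightarrow> bool" where
  "cont_invertible V \<C> W \<D> T \<longleftrightarrow> cont_linear V \<C> W \<D> T \<and>
     (\<exists>T'. cont_linear W \<D> V \<C> T' \<and> (\<forall>v\<in>V. T' (T v) = v) \<and> (\<forall>w\<in>W. T (T' w) = w))"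

definition tangent_coords ::
  "('p, 'b) chart set \<Rightarrow> 'p \<Rightarrow> (('p, 'b) tvec \<Rightarrow> 'b) set" where
  "tangent_coords \<A> x = (\<lambda>c v. v c) ` charts_at \<A> x"

definition tangent_norms ::
  "('p, 'b::real_normed_vector) chart set \<Rightarrow> ('p \<Rightarrow> ('p, 'b) tvec \<Rightarrow> real) \<Rightarrow> bool" where
  "tangent_norms \<A> N \<longleftrightarrow> (\<forall>x.
     (\<forall>v\<in>tangent_space \<A> x. \<forall>w\<in>tangent_space \<A> x. N x (v + w) \<le> N x v + N x w) \<and>
     (\<forall>r. \<forall>v\<in>tangent_space \<A> x. N x (r *\<^sub>R v) = \<bar>r\<bar> * N x v) \<and>
     (\<forall>v\<in>tangent_space \<A> x. N x v = 0 \<longleftrightarrow> v = 0) \<and>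
     (\<forall>a\<in>tangent_coords \<A> x. \<exists>m>0. \<exists>M>0. \<forall>v\<in>tangent_space \<A> x.
        m * norm (a v) \<le> N x v \<and> N x v \<le> M * norm (a v)))"


section \<open>Vector bundles\<close>

text \<open>A local trivialization over \<open>U\<close> is given by \<open>U\<close> and the principal part \<open>\<tau>\<close>, so that
  \<open>e \<mapsto> (p e, \<tau> e)\<close> maps \<open>p\<^sup>-\<^sup>1(U)\<close> onto \<open>U \<times> UNIV\<close>. Sums of elements of different fibres are
  irrelevant.\<close>

record ('e, 'y, 'f) vbundle =
  proj :: "'e \<Rightarrow> 'y"
  vadd :: "'e \<Rightarrow> 'e \<Rightarrow> 'e"
  vscale :: "real \<Rightarrow> 'e \<Rightarrow> 'e"
  vzero :: "'y \<Rightarrow> 'e"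
  trivs :: "('y set \<times> ('e \<Rightarrow> 'f)) set"

definition vsub :: "('e, 'y, 'f) vbundle \<Rightarrow> 'e \<Rightarrow> 'e \<Rightarrow> 'e" where
  "vsub B e e' = vadd B e (vscale B (-1) e')"

definition fibre :: "('e, 'y, 'f) vbundle \<Rightarrow> 'y \<Rightarrow> 'e set" where
  "fibre B y = {e. proj B e = y}"

definition fibre_coords :: "('e, 'y, 'f) vbundle \<Rightarrow> 'y \<Rightarrow> ('e \<Rightarrow> 'f) set" where
  "fibre_coords B y = {\<tau>. \<exists>U. (U, \<tau>) \<in> trivs B \<and> y \<in> U}"

text \<open>The bundle carries an arbitrary \<open>C\<^sup>1\<close> atlas \<open>\<E>\<close> on its total space for which the
  trivializations are \<open>C\<^sup>1\<close> diffeomorphisms. As usual for infinite-dimensional fibres, the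
  transition maps are \<open>C\<^sup>1\<close> in the operator norm.\<close>

definition C1_vector_bundle ::
  "('e::topological_space, 'g::banach) chart set \<Rightarrow> ('y::topological_space, 'm::banach) chart set
     \<Rightarrow> ('e, 'y, 'f::banach) vbundle \<Rightarrow> bool" where
  "C1_vector_bundle \<E> \<Y> B \<longleftrightarrow>
     C1_manifold \<E> \<and> C1_manifold \<Y> \<and> C1_map \<E> \<Y> UNIV (proj B) \<and>
     (\<Union>t\<in>trivs B. fst t) = UNIV \<and>
     (\<forall>(U, \<tau>)\<in>trivs B. open U \<and>
        (\<forall>y\<in>U. bij_betw \<tau> (fibre B y) UNIV \<and>
           vzero B y \<in> fibre B y \<and> \<tau> (vzero B y) = 0 \<and>
           (\<forall>e\<in>fibre B y. \<forall>e'\<in>fibre B y.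
              vadd B e e' \<in> fibre B y \<and> \<tau> (vadd B e e') = \<tau> e + \<tau> e') \<and>
           (\<forall>r. \<forall>e\<in>fibre B y. vscale B r e \<in> fibre B y \<and> \<tau> (vscale B r e) = r *\<^sub>R \<tau> e)) \<and>
        C1_map \<E> (prod_atlas \<Y> {(UNIV, id)}) (proj B -` U) (\<lambda>e. (proj B e, \<tau> e)) \<and>
        C1_map (prod_atlas \<Y> {(UNIV, id)}) \<E> (U \<times> UNIV)
          (\<lambda>(y, f). inv_into (fibre B y) \<tau> f)) \<and>
     (\<forall>(U, \<tau>)\<in>trivs B. \<forall>(U', \<tau>')\<in>trivs B.
        C1_operator_map \<Y> (U \<inter> U') (\<lambda>y. \<tau>' \<circ> inv_into (fibre B y) \<tau>))"


section \<open>Strict differentiability\<close>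

text \<open>\<open>DF :: T\<^sub>x\<X> \<rightarrow> T\<^bsub>F x\<^esub>\<E>\<close> is the strict derivative of \<open>F\<close> at \<open>x\<close>. The neighbourhood \<open>N\<close> has to
  lie in the domain of the chart representation.\<close>

definition has_strict_derivative ::
  "('p::topological_space, 'b::banach) chart set \<Rightarrow> ('q::topological_space, 'c::banach) chart set
     \<Rightarrow> ('p \<Rightarrow> 'q) \<Rightarrow> 'p \<Rightarrow> (('p, 'b) tvec \<Rightarrow> ('q, 'c) tvec) \<Rightarrow> bool" where
  "has_strict_derivative \<A> \<B> F x DF \<longleftrightarrow>
     cont_linear (tangent_space \<A> x) (tangent_coords \<A> x)
       (tangent_space \<B> (F x)) (tangent_coords \<B> (F x)) DF \<and>
     (\<forall>(U, \<phi>)\<in>charts_at \<A> x. \<forall>(W, \<psi>)\<in>charts_at \<B> (F x). \<forall>\<epsilon>>0.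
        \<exists>N. open N \<and> \<phi> x \<in> N \<and> N \<subseteq> \<phi> ` (U \<inter> F -` W) \<and>
          (\<forall>\<xi>\<in>N. \<forall>\<eta>\<in>N. \<xi> \<noteq> \<eta> \<longrightarrow>
             norm (DF (tvec_of \<A> x (U, \<phi>) (\<xi> - \<eta>)) (W, \<psi>) -
                   ((\<psi> \<circ> F \<circ> inv_into U \<phi>) \<xi> - (\<psi> \<circ> F \<circ> inv_into U \<phi>) \<eta>))
               < \<epsilon> * norm (\<xi> - \<eta>)))"


section \<open>Connection maps, back-transports, retractions\<close>

definition vertical_lift ::
  "('e, 'g::banach) chart set \<Rightarrow> ('e, 'y, 'f) vbundle \<Rightarrow> 'e \<Rightarrow> 'e \<Rightarrow> ('e, 'g) tvec" where
  "vertical_lift \<E> B e w = velocity \<E> (\<lambda>t. vadd B e (vscale B t w)) 0"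

definition connection_map ::
  "('e, 'g::banach) chart set \<Rightarrow> ('e, 'y, 'f::banach) vbundle
     \<Rightarrow> ('e \<Rightarrow> ('e, 'g) tvec \<Rightarrow> 'e) \<Rightarrow> bool" where
  "connection_map \<E> B Q \<longleftrightarrow> (\<forall>e.
     cont_linear (tangent_space \<E> e) (tangent_coords \<E> e)
       (fibre B (proj B e)) (fibre_coords B (proj B e)) (Q e) \<and>
     (\<forall>w\<in>fibre B (proj B e). Q e (vertical_lift \<E> B e w) = w))"

text \<open>\<open>V y'\<close> is the transport from the fibre over \<open>y'\<close> back to the fixed fibre over \<open>y\<close>.\<close>

definition vector_back_transport ::
  "('y::topological_space, 'm::banach) chart set \<Rightarrow> ('e, 'y, 'f::banach) vbundle
     \<Rightarrow> 'y \<Rightarrow> ('y \<Rightarrow> 'e \<Rightarrow> 'e) \<Rightarrow> bool" where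
  "vector_back_transport \<Y> B y V \<longleftrightarrow>
     (\<forall>y'. cont_invertible (fibre B y') (fibre_coords B y') (fibre B y) (fibre_coords B y) (V y')) \<and>
     (\<forall>e\<in>fibre B y. V y e = e) \<and>
     (\<forall>\<tau>\<in>fibre_coords B y. \<forall>(U', \<tau>')\<in>trivs B.
        C1_operator_map \<Y> U' (\<lambda>y'. \<tau> \<circ> V y' \<circ> inv_into (fibre B y') \<tau>'))"

definition transport_map :: "('e, 'y, 'f) vbundle \<Rightarrow> ('y \<Rightarrow> 'e \<Rightarrow> 'e) \<Rightarrow> 'e \<Rightarrow> 'e" where
  "transport_map B V e = V (proj B e) e"

text \<open>\<open>Q\<^sub>e\<close> is the derivative at \<open>e\<close> of \<open>\<langle>V\<rangle> : \<E> \<rightarrow> E\<^sub>y\<close>, where \<open>y = p(e)\<close>.\<close>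

definition consistent_at ::
  "('e, 'g::banach) chart set \<Rightarrow> ('e, 'y, 'f::banach) vbundle \<Rightarrow> ('y \<Rightarrow> 'e \<Rightarrow> 'e)
     \<Rightarrow> ('e \<Rightarrow> ('e, 'g) tvec \<Rightarrow> 'e) \<Rightarrow> 'e \<Rightarrow> bool" where
  "consistent_at \<E> B V Q e \<longleftrightarrow>
     (\<forall>(W, \<psi>)\<in>charts_at \<E> e. \<forall>\<tau>\<in>fibre_coords B (proj B e).
        (\<tau> \<circ> transport_map B V \<circ> inv_into W \<psi>
           has_derivative (\<lambda>u. \<tau> (Q e (tvec_of \<E> e (W, \<psi>) u)))) (at (\<psi> e)))"

text \<open>\<open>R x v\<close> is \<open>R\<^sub>x(v)\<close>. The natural chart of the tangent bundle belonging to \<open>(U, \<phi>)\<close> maps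
  \<open>v \<in> T\<^sub>x\<X>\<close> to \<open>(\<phi> x, v (U, \<phi>))\<close>.\<close>

definition C1_retraction ::
  "('x::topological_space, 'b::banach) chart set \<Rightarrow> ('x \<Rightarrow> ('x, 'b) tvec \<Rightarrow> 'x) \<Rightarrow> bool" where
  "C1_retraction \<X> R \<longleftrightarrow>
     (\<forall>(U, \<phi>)\<in>\<X>. \<forall>(W, \<psi>)\<in>\<X>.
        let R' = (\<lambda>(\<xi>, u). R (inv_into U \<phi> \<xi>) (tvec_of \<X> (inv_into U \<phi> \<xi>) (U, \<phi>) u))
        in C1_on (\<psi> \<circ> R') ((\<phi> ` U \<times> UNIV) \<inter> R' -` W)) \<and>
     (\<forall>x. R x 0 = x \<and>
        (\<forall>(U, \<phi>)\<in>charts_at \<X> x.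
           ((\<lambda>u. \<phi> (R x (tvec_of \<X> x (U, \<phi>) u))) has_derivative (\<lambda>u. u)) (at 0)))"


section \<open>Newton directions and damping\<close>

definition newton_direction ::
  "('x, 'b::real_normed_vector) chart set \<Rightarrow> ('e, 'y, 'f) vbundle \<Rightarrow> ('e \<Rightarrow> ('e, 'g) tvec \<Rightarrow> 'e)
     \<Rightarrow> ('x \<Rightarrow> 'e) \<Rightarrow> 'x \<Rightarrow> (('x, 'b) tvec \<Rightarrow> ('e, 'g) tvec) \<Rightarrow> ('x, 'b) tvec \<Rightarrow> bool" where
  "newton_direction \<X> B Q F x DF \<delta> \<longleftrightarrow>
     \<delta> \<in> tangent_space \<X> x \<and> vadd B (Q (F x) (DF \<delta>)) (F x) = vzero B (proj B (F x))"

text \<open>In the following two definitions \<open>V\<close> is the back-transport to the fibre over \<open>p(F x)\<close>.\<close>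

definition simplified_newton_direction ::
  "('x, 'b::real_normed_vector) chart set \<Rightarrow> ('e, 'y, 'f) vbundle \<Rightarrow> ('e \<Rightarrow> ('e, 'g) tvec \<Rightarrow> 'e)
     \<Rightarrow> ('y \<Rightarrow> 'e \<Rightarrow> 'e) \<Rightarrow> ('x \<Rightarrow> ('x, 'b) tvec \<Rightarrow> 'x)
     \<Rightarrow> ('x \<Rightarrow> 'e) \<Rightarrow> 'x \<Rightarrow> (('x, 'b) tvec \<Rightarrow> ('e, 'g) tvec) \<Rightarrow> ('x, 'b) tvec \<Rightarrow> real
     \<Rightarrow> ('x, 'b) tvec" where
  "simplified_newton_direction \<X> B Q V R F x DF \<delta> \<alpha> =
     (let x' = R x (\<alpha> *\<^sub>R \<delta>) in
      THE d. d \<in> tangent_space \<X> x \<and>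
        vsub B (vadd B (Q (F x) (DF d)) (V (proj B (F x')) (F x'))) (vscale B (1 - \<alpha>) (F x))
          = vzero B (proj B (F x)))"

definition damping_theta ::
  "('x, 'b::real_normed_vector) chart set \<Rightarrow> ('x \<Rightarrow> ('x, 'b) tvec \<Rightarrow> real)
     \<Rightarrow> ('e, 'y, 'f) vbundle \<Rightarrow> ('e \<Rightarrow> ('e, 'g) tvec \<Rightarrow> 'e)
     \<Rightarrow> ('y \<Rightarrow> 'e \<Rightarrow> 'e) \<Rightarrow> ('x \<Rightarrow> ('x, 'b) tvec \<Rightarrow> 'x)
     \<Rightarrow> ('x \<Rightarrow> 'e) \<Rightarrow> 'x \<Rightarrow> (('x, 'b) tvec \<Rightarrow> ('e, 'g) tvec) \<Rightarrow> ('x, 'b) tvec \<Rightarrow> real \<Rightarrow> real" where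
  "damping_theta \<X> N B Q V R F x DF \<delta> \<alpha> =
     N x (simplified_newton_direction \<X> B Q V R F x DF \<delta> \<alpha>) / N x (\<alpha> *\<^sub>R \<delta>)"

text \<open>Step sizes of the inner loop: the recursion is only imposed as long as the loop has not been
  stopped; entries after the stopping index are arbitrary.\<close>

definition backtracking_run ::
  "(real \<Rightarrow> real) \<Rightarrow> real \<Rightarrow> real \<Rightarrow> (nat \<Rightarrow> real) \<Rightarrow> bool" where
  "backtracking_run \<theta> \<Theta>\<^sub>d\<^sub>e\<^sub>s \<Theta>\<^sub>a\<^sub>c\<^sub>c a \<longleftrightarrow>
     (\<forall>j. (\<forall>i\<le>j. \<not> \<theta> (a i) \<le> \<Theta>\<^sub>a\<^sub>c\<^sub>c) \<longrightarrow> a (Suc j) = min 1 (a j * \<Theta>\<^sub>d\<^sub>e\<^sub>s / \<theta> (a j)))"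

end

theory Submission
  imports Defs
begin

text \<open>In coordinates, the transported residual \<open>h(\<alpha>) = \<langle>V\<rangle>(F(R\<^sub>x(\<alpha> \<delta>x)))\<close> is differentiable at \<open>0\<close>
  by the chain rule. Consistency of \<open>V\<close> with \<open>Q\<close> turns its derivative into \<open>Q \<circ> F'(x) \<delta>x = - F(x)\<close>,
  so \<open>h(\<alpha>) - (1 - \<alpha>) F(x) = o(\<alpha>)\<close>. The simplified Newton direction is the image of this remainder
  under a bounded operator, whence \<open>\<theta>(\<alpha>) \<rightarrow> 0\<close>. Each rejected step shrinks \<open>\<alpha>\<close> at least by the
  factor \<open>\<Theta>\<^sub>d\<^sub>e\<^sub>s / \<Theta>\<^sub>a\<^sub>c\<^sub>c < 1\<close>, so rejections cannot go on forever.\<close>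

section \<open>Tangent vectors and their coordinates\<close>

lemma charts_at_nonempty:
  assumes "C1_manifold \<A>"
  obtains U \<phi> where "(U, \<phi>) \<in> charts_at \<A> x"
proof -
  have "x \<in> (\<Union>c\<in>\<A>. fst c)" using assms by (simp add: C1_manifold_def)
  then obtain c where "c \<in> \<A>" "x \<in> fst c" by blast
  then show ?thesis using that[of "fst c" "snd c"] by (simp add: charts_at_def)
qed

lemma chart_inv_into:
  assumes "C1_manifold \<A>" "(U, \<phi>) \<in> charts_at \<A> x" "z \<in> U"
  shows "inv_into U \<phi> (\<phi> z) = z"
  using assms unfolding C1_manifold_def charts_at_def homeomorphism_def by fastforce

lemma tvec_of_in_tangent_space:
  assumes "C1_manifold \<A>" "c \<in> charts_at \<A> x"
  shows "tvec_of \<A> x c u \<in> tangent_space \<A> x"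
  using bij_betw_tangent_coord[OF assms] unfolding tvec_of_def bij_betw_def
  by (simp add: inv_into_into)

lemma tvec_of_coord:
  assumes "C1_manifold \<A>" "c \<in> charts_at \<A> x"
  shows "tvec_of \<A> x c u c = u"
  using f_inv_into_f[of u "\<lambda>v. v c" "tangent_space \<A> x"] bij_betw_tangent_coord[OF assms]
  unfolding tvec_of_def bij_betw_def by simp

lemma coord_tvec_of:
  assumes "C1_manifold \<A>" "c \<in> charts_at \<A> x" "v \<in> tangent_space \<A> x"
  shows "tvec_of \<A> x c (v c) = v"
  using inv_into_f_f[of "\<lambda>v. v c" "tangent_space \<A> x" v] assms bij_betw_tangent_coord[OF assms(1,2)]
  unfolding tvec_of_def bij_betw_def by simp

lemma scaleR_in_tangent_space:
  assumes A: "C1_manifold \<A>" and v: "v \<in> tangent_space \<A> x"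
  shows "r *\<^sub>R v \<in> tangent_space \<A> x"
proof -
  have "(r *\<^sub>R v) (W, \<psi>) = frechet_derivative (\<psi> \<circ> inv_into U \<phi>) (at (\<phi> x)) ((r *\<^sub>R v) (U, \<phi>))"
    if U: "(U, \<phi>) \<in> charts_at \<A> x" and W: "(W, \<psi>) \<in> charts_at \<A> x" for U \<phi> W \<psi>
  proof -
    \<comment> \<open>\<open>frechet_derivative\<close> is a choice operator and is known to be
      linear only where a derivative exists, so differentiability of the transition map comes
      first.\<close>
    have "C1_on (\<psi> \<circ> inv_into U \<phi>) (\<phi> ` (U \<inter> W))" "\<phi> x \<in> \<phi> ` (U \<inter> W)"
      using A U W unfolding C1_manifold_def charts_at_def by fastforce+
    then have "linear (frechet_derivative (\<psi> \<circ> inv_into U \<phi>) (at (\<phi> x)))"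
      using C1_on_frechet has_derivative_linear by blast
    moreover have "v (W, \<psi>) = frechet_derivative (\<psi> \<circ> inv_into U \<phi>) (at (\<phi> x)) (v (U, \<phi>))"
      using v U W unfolding tangent_space_def by fastforce
    ultimately show ?thesis by (simp add: scaleR_fun_def linear_cmul)
  qed
  moreover have "(r *\<^sub>R v) c = 0" if "c \<notin> charts_at \<A> x" for c
    using v that by (cases c) (simp add: tangent_space_def scaleR_fun_def)
  ultimately show ?thesis unfolding tangent_space_def by auto
qed

section \<open>Derivatives of F and of the retraction in charts\<close>

lemma has_strict_derivativeE:
  assumes "has_strict_derivative \<A> \<B> F x DF"
    and "(U, \<phi>) \<in> charts_at \<A> x" "(W, \<psi>) \<in> charts_at \<B> (F x)" "\<epsilon> > 0"
  obtains M where "open M" "\<phi> x \<in> M" "M \<subseteq> \<phi> ` (U \<inter> F -` W)"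
    and "\<And>\<xi> \<eta>. \<xi> \<in> M \<Longrightarrow> \<eta> \<in> M \<Longrightarrow> \<xi> \<noteq> \<eta> \<Longrightarrow>
      norm (DF (tvec_of \<A> x (U, \<phi>) (\<xi> - \<eta>)) (W, \<psi>) -
        ((\<psi> \<circ> F \<circ> inv_into U \<phi>) \<xi> - (\<psi> \<circ> F \<circ> inv_into U \<phi>) \<eta>)) < \<epsilon> * norm (\<xi> - \<eta>)"
proof -
  have "\<forall>(U, \<phi>)\<in>charts_at \<A> x. \<forall>(W, \<psi>)\<in>charts_at \<B> (F x). \<forall>\<epsilon>>0.
        \<exists>N. open N \<and> \<phi> x \<in> N \<and> N \<subseteq> \<phi> ` (U \<inter> F -` W) \<and>
          (\<forall>\<xi>\<in>N. \<forall>\<eta>\<in>N. \<xi> \<noteq> \<eta> \<longrightarrow>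
             norm (DF (tvec_of \<A> x (U, \<phi>) (\<xi> - \<eta>)) (W, \<psi>) -
                   ((\<psi> \<circ> F \<circ> inv_into U \<phi>) \<xi> - (\<psi> \<circ> F \<circ> inv_into U \<phi>) \<eta>))
               < \<epsilon> * norm (\<xi> - \<eta>))"
    using assms(1) unfolding has_strict_derivative_def by (rule conjunct2)
  from mp[OF spec[OF bspec[OF bspec[OF this assms(2), unfolded prod.case] assms(3), unfolded prod.case]]
      assms(4)]
  show thesis by (elim exE conjE) (rule that, assumption+, blast)
qed

text \<open>Freezing the second point of the strict estimate at \<open>\<phi> x\<close> leaves the
  Frechet estimate. Boundedness of the derivative does not follow from that estimate; it comes from
  \<open>cont_linear\<close>.\<close>

lemma has_strict_derivative_imp_has_derivative:
  assumes A: "C1_manifold \<A>" and F: "has_strict_derivative \<A> \<B> F x DF"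
    and U: "(U, \<phi>) \<in> charts_at \<A> x" and W: "(W, \<psi>) \<in> charts_at \<B> (F x)"
  shows "(\<psi> \<circ> F \<circ> inv_into U \<phi> has_derivative (\<lambda>u. DF (tvec_of \<A> x (U, \<phi>) u) (W, \<psi>))) (at (\<phi> x))"
proof -
  let ?f = "\<psi> \<circ> F \<circ> inv_into U \<phi>" and ?D = "\<lambda>u. DF (tvec_of \<A> x (U, \<phi>) u) (W, \<psi>)"
  have "(\<lambda>v. v (U, \<phi>)) \<in> tangent_coords \<A> x" "(\<lambda>v. v (W, \<psi>)) \<in> tangent_coords \<B> (F x)"
    using U W by (auto simp: tangent_coords_def)
  then obtain L where L: "bounded_linear L"
      "\<And>v. v \<in> tangent_space \<A> x \<Longrightarrow> DF v (W, \<psi>) = L (v (U, \<phi>))"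
    using F unfolding has_strict_derivative_def cont_linear_def by meson
  have DL: "?D = L"
    using L(2)[OF tvec_of_in_tangent_space[OF A U]] tvec_of_coord[OF A U] by auto
  have "\<exists>d>0. \<forall>\<xi>. norm (\<xi> - \<phi> x) < d \<longrightarrow>
      norm (?f \<xi> - ?f (\<phi> x) - ?D (\<xi> - \<phi> x)) \<le> \<epsilon> * norm (\<xi> - \<phi> x)" if "\<epsilon> > 0" for \<epsilon>
  proof -
    obtain M where M: "open M" "\<phi> x \<in> M" and
      strict: "\<And>\<xi> \<eta>. \<xi> \<in> M \<Longrightarrow> \<eta> \<in> M \<Longrightarrow> \<xi> \<noteq> \<eta> \<Longrightarrow>
        norm (?D (\<xi> - \<eta>) - (?f \<xi> - ?f \<eta>)) < \<epsilon> * norm (\<xi> - \<eta>)"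
      by (rule has_strict_derivativeE[OF F U W \<open>\<epsilon> > 0\<close>]) blast
    obtain d where d: "d > 0" "ball (\<phi> x) d \<subseteq> M" using M openE by blast
    have "norm (?f \<xi> - ?f (\<phi> x) - ?D (\<xi> - \<phi> x)) \<le> \<epsilon> * norm (\<xi> - \<phi> x)" if "norm (\<xi> - \<phi> x) < d" for \<xi>
    \<comment> \<open>The strict estimate covers distinct points only; at \<open>\<phi> x\<close>
      itself both sides vanish, because ?D 0 = 0.\<close>
    proof (cases "\<xi> = \<phi> x")
      case True
      then show ?thesis using linear_0[OF bounded_linear.linear[OF L(1)]] fun_cong[OF DL, of 0] by simp
    next
      case False
      have "\<xi> \<in> M" using d that by (auto simp: dist_norm norm_minus_commute)
      then show ?thesis using strict[of \<xi> "\<phi> x"] M False by (simp add: norm_minus_commute)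
    qed
    then show ?thesis using d by blast
  qed
  moreover have "bounded_linear ?D" using L(1) unfolding DL .
  ultimately show ?thesis unfolding has_derivative_at_alt by simp
qed

text \<open>The derivative is the chain rule along the line t \<mapsto> t u, with the derivative of
  R at the zero vector being the identity. It does not show that the curve stays in U, as values of
  \<open>\<phi>\<close> off U are arbitrary. That second claim comes from the openness contained in
  \<open>C1_on\<close>.\<close>

lemma retraction_curve:
  assumes A: "C1_manifold \<X>" and R: "C1_retraction \<X> R" and U: "(U, \<phi>) \<in> charts_at \<X> x"
    and v: "v \<in> tangent_space \<X> x"
  shows "((\<lambda>t. \<phi> (R x (t *\<^sub>R v))) has_vector_derivative v (U, \<phi>)) (at 0)"
    and "\<forall>\<^sub>F t in at 0. R x (t *\<^sub>R v) \<in> U"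
proof -
  let ?u = "v (U, \<phi>)"
  have xU: "x \<in> U" using U by (simp add: charts_at_def)
  have coord: "tvec_of \<X> x (U, \<phi>) (t *\<^sub>R ?u) = t *\<^sub>R v" for t
    using coord_tvec_of[OF A U scaleR_in_tangent_space[OF A v, of t]] by (simp add: scaleR_fun_def)
  have "((\<lambda>u. \<phi> (R x (tvec_of \<X> x (U, \<phi>) u))) has_derivative (\<lambda>u. u)) (at (0 *\<^sub>R ?u))"
    using R U unfolding C1_retraction_def by auto
  moreover have "((\<lambda>t. t *\<^sub>R ?u) has_derivative (\<lambda>t. t *\<^sub>R ?u)) (at 0)"
    by (auto intro!: derivative_eq_intros)
  ultimately have "((\<lambda>t. \<phi> (R x (tvec_of \<X> x (U, \<phi>) (t *\<^sub>R ?u)))) has_derivative (\<lambda>t. t *\<^sub>R ?u)) (at 0)"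
    using has_derivative_compose by fastforce
  then show "((\<lambda>t. \<phi> (R x (t *\<^sub>R v))) has_vector_derivative ?u) (at 0)"
    unfolding has_vector_derivative_def coord .
  \<comment> \<open>The retraction read in the tangent bundle chart of \<open>(U, \<phi>)\<close>.
    With the same chart as target, the open set ?S consists of the coordinates that R sends into
    U.\<close>
  define R' where
    "R' = (\<lambda>(\<xi>, u). R (inv_into U \<phi> \<xi>) (tvec_of \<X> (inv_into U \<phi> \<xi>) (U, \<phi>) u))"
  let ?S = "(\<phi> ` U \<times> UNIV) \<inter> R' -` U"
  have "C1_on (\<phi> \<circ> R') ?S"
    using R U unfolding C1_retraction_def R'_def charts_at_def Let_def by fastforce
  then have S: "open ?S" by (simp add: C1_on_def)
  have R'_eq: "R' (\<phi> x, t *\<^sub>R ?u) = R x (t *\<^sub>R v)" for t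
    unfolding R'_def using chart_inv_into[OF A U xU] coord by simp
  have "(\<phi> x, 0 *\<^sub>R ?u) \<in> ?S"
    using R'_eq[of 0] R xU unfolding C1_retraction_def by auto
  moreover have "((\<lambda>t. (\<phi> x, t *\<^sub>R ?u)) \<longlongrightarrow> (\<phi> x, 0 *\<^sub>R ?u)) (at 0)"
    by (intro tendsto_intros)
  ultimately have "\<forall>\<^sub>F t in at 0. (\<phi> x, t *\<^sub>R ?u) \<in> ?S"
    using S topological_tendstoD by blast
  then show "\<forall>\<^sub>F t in at 0. R x (t *\<^sub>R v) \<in> U"
    by (rule eventually_mono) (simp add: R'_eq)
qed

text \<open>The chain rule differentiates the composite of three chart representations: retraction
  curve, F, transport. That composite is the intended curve only while no point leaves its chart
  domain, so the derivative is transferred by equality near 0 and at 0.\<close>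

lemma transported_residual_derivative:
  assumes X: "C1_manifold \<X>" and E: "C1_manifold \<E>"
    and R: "C1_retraction \<X> R" and F: "has_strict_derivative \<X> \<E> F x DF"
    and cons: "consistent_at \<E> B V Q (F x)"
    and \<tau>: "\<tau> \<in> fibre_coords B (proj B (F x))" and v: "v \<in> tangent_space \<X> x"
  shows "((\<lambda>t. \<tau> (transport_map B V (F (R x (t *\<^sub>R v))))) has_vector_derivative
           \<tau> (Q (F x) (DF v))) (at 0)"
proof -
  obtain U \<phi> where U: "(U, \<phi>) \<in> charts_at \<X> x" using charts_at_nonempty[OF X] .
  obtain W \<psi> where W: "(W, \<psi>) \<in> charts_at \<E> (F x)" using charts_at_nonempty[OF E] .
  have xU: "x \<in> U" using U by (simp add: charts_at_def)
  have R0: "R x (0 *\<^sub>R v) = x" using R by (simp add: C1_retraction_def)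
  let ?\<gamma> = "\<lambda>t. \<phi> (R x (t *\<^sub>R v))" and ?f = "\<psi> \<circ> F \<circ> inv_into U \<phi>"
  let ?T = "\<tau> \<circ> transport_map B V \<circ> inv_into W \<psi>"
  have fx: "?f (\<phi> x) = \<psi> (F x)" using chart_inv_into[OF X U xU] by simp
  have "(?T has_derivative (\<lambda>u. \<tau> (Q (F x) (tvec_of \<E> (F x) (W, \<psi>) u)))) (at (?f (\<phi> x)))"
    using cons W \<tau> unfolding consistent_at_def fx by fast
  from diff_chain_at[OF has_strict_derivative_imp_has_derivative[OF X F U W] this]
  have "(?T \<circ> ?f has_derivative (\<lambda>u. \<tau> (Q (F x) (tvec_of \<E> (F x) (W, \<psi>)
      (DF (tvec_of \<X> x (U, \<phi>) u) (W, \<psi>)))))) (at (?\<gamma> 0))"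
    unfolding R0 by (simp add: o_def)
  then have "(?T \<circ> ?f has_derivative (\<lambda>u. \<tau> (Q (F x) (tvec_of \<E> (F x) (W, \<psi>)
      (DF (tvec_of \<X> x (U, \<phi>) u) (W, \<psi>)))))) (at (?\<gamma> 0) within range ?\<gamma>)"
    by (rule has_derivative_at_withinI)
  from vector_derivative_diff_chain_within[OF retraction_curve(1)[OF X R U v] this]
  have "(?T \<circ> ?f \<circ> ?\<gamma> has_vector_derivative \<tau> (Q (F x) (tvec_of \<E> (F x) (W, \<psi>)
      (DF v (W, \<psi>))))) (at 0)"
    unfolding coord_tvec_of[OF X U v] .
  moreover have "DF v \<in> tangent_space \<E> (F x)"
    using F v unfolding has_strict_derivative_def cont_linear_def by blast
  ultimately have deriv: "(?T \<circ> ?f \<circ> ?\<gamma> has_vector_derivative \<tau> (Q (F x) (DF v))) (at 0)"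
    using coord_tvec_of[OF E W] by simp
  \<comment> \<open>The constant 1 is arbitrary: what is wanted is a neighbourhood M whose points
    come from U and are mapped by F into W.\<close>
  obtain M where M: "open M" "\<phi> x \<in> M" "M \<subseteq> \<phi> ` (U \<inter> F -` W)"
    by (rule has_strict_derivativeE[OF F U W zero_less_one]) blast
  have "(?\<gamma> \<longlongrightarrow> ?\<gamma> 0) (at 0)"
    using has_vector_derivative_continuous[OF retraction_curve(1)[OF X R U v]] isCont_def by blast
  then have "\<forall>\<^sub>F t in at 0. ?\<gamma> t \<in> M"
    using M(1,2) unfolding R0 by (rule topological_tendstoD)
  then have ev: "\<forall>\<^sub>F t in at 0. (?T \<circ> ?f \<circ> ?\<gamma>) t = \<tau> (transport_map B V (F (R x (t *\<^sub>R v))))"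
    using retraction_curve(2)[OF X R U v]
  proof eventually_elim
    case (elim t)
    \<comment> \<open>A priori z need not be the point on the curve, as M only constrains
      coordinates. Since the curve lies in U, injectivity of \<open>\<phi>\<close> there identifies
      the two.\<close>
    then obtain z where z: "z \<in> U" "F z \<in> W" "?\<gamma> t = \<phi> z" using M(3) by blast
    then have "R x (t *\<^sub>R v) = z" using elim(2) chart_inv_into[OF X U] by metis
    then show ?case using chart_inv_into[OF X U z(1)] chart_inv_into[OF E W z(2)] by simp
  qed
  \<comment> \<open>The filter \<open>at 0\<close> omits 0, so equality at 0 is checked
    separately.\<close>
  have "F x \<in> W" using W by (simp add: charts_at_def)
  then have "(?T \<circ> ?f \<circ> ?\<gamma>) 0 = \<tau> (transport_map B V (F (R x (0 *\<^sub>R v))))"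
    using chart_inv_into[OF X U xU] chart_inv_into[OF E W] unfolding R0 comp_apply by simp
  then show ?thesis using deriv ev
    unfolding has_vector_derivative_def by (simp add: has_derivative_transform_eventually)
qed

text \<open>Solving the defining equation for d means applying the inverse of
  \<open>Q (F x) \<circ> DF\<close> to a fibre element. K represents this inverse in coordinates,
  hence is bounded and, crucially, the same for all \<open>\<alpha>\<close>.\<close>

lemma simplified_newton_direction_coord:
  assumes vb: "C1_vector_bundle \<E> \<Y> B"
    and V: "vector_back_transport \<Y> B y V" and y: "y = proj B (F x)"
    and inv: "cont_invertible (tangent_space \<X> x) (tangent_coords \<X> x)
           (fibre B y) (fibre_coords B y) (Q (F x) \<circ> DF)"
    and a: "a \<in> tangent_coords \<X> x" and \<tau>: "\<tau> \<in> fibre_coords B y"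
  obtains K where "bounded_linear K"
    and "\<And>\<alpha>. let d = simplified_newton_direction \<X> B Q V R F x DF \<delta> \<alpha> in
         d \<in> tangent_space \<X> x \<and>
         a d = K ((1 - \<alpha>) *\<^sub>R \<tau> (F x) - \<tau> (transport_map B V (F (R x (\<alpha> *\<^sub>R \<delta>)))))"
proof -
  let ?TX = "tangent_space \<X> x" and ?A = "Q (F x) \<circ> DF"
  obtain T where T: "(T, \<tau>) \<in> trivs B" "y \<in> T" using \<tau> by (auto simp: fibre_coords_def)
  then have bij: "bij_betw \<tau> (fibre B y) UNIV" and
    zero: "vzero B y \<in> fibre B y" "\<tau> (vzero B y) = 0" and
    add: "\<And>e e'. e \<in> fibre B y \<Longrightarrow> e' \<in> fibre B y \<Longrightarrow>
      vadd B e e' \<in> fibre B y \<and> \<tau> (vadd B e e') = \<tau> e + \<tau> e'" and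
    scale: "\<And>r e. e \<in> fibre B y \<Longrightarrow> vscale B r e \<in> fibre B y \<and> \<tau> (vscale B r e) = r *\<^sub>R \<tau> e"
    using vb unfolding C1_vector_bundle_def by fast+
  have AW: "?A ` ?TX \<subseteq> fibre B y"
    using inv unfolding cont_invertible_def cont_linear_def by (elim conjE)
  from inv obtain A' where
    A'lin: "cont_linear (fibre B y) (fibre_coords B y) ?TX (tangent_coords \<X> x) A'" and
    A': "\<And>v. v \<in> ?TX \<Longrightarrow> A' (?A v) = v" "\<And>w. w \<in> fibre B y \<Longrightarrow> ?A (A' w) = w"
    unfolding cont_invertible_def by blast
  from A'lin have A'W: "\<And>w. w \<in> fibre B y \<Longrightarrow> A' w \<in> ?TX" unfolding cont_linear_def by blast
  have "\<forall>a\<in>fibre_coords B y. \<forall>b\<in>tangent_coords \<X> x.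
      \<exists>L. bounded_linear L \<and> (\<forall>w\<in>fibre B y. b (A' w) = L (a w))"
    using A'lin unfolding cont_linear_def by (rule conjunct2)
  from bspec[OF bspec[OF this \<tau>] a]
  obtain K where K: "bounded_linear K" "\<And>w. w \<in> fibre B y \<Longrightarrow> a (A' w) = K (\<tau> w)"
    by blast
  have Fx: "F x \<in> fibre B y" using y by (simp add: fibre_def)
  have "let d = simplified_newton_direction \<X> B Q V R F x DF \<delta> \<alpha> in
         d \<in> ?TX \<and> a d = K ((1 - \<alpha>) *\<^sub>R \<tau> (F x) - \<tau> (transport_map B V (F (R x (\<alpha> *\<^sub>R \<delta>)))))" for \<alpha>
  proof -
    define g where "g = F (R x (\<alpha> *\<^sub>R \<delta>))"
    have "V (proj B g) ` fibre B (proj B g) \<subseteq> fibre B y"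
      using V unfolding vector_back_transport_def cont_invertible_def cont_linear_def by meson
    then have Vg: "V (proj B g) g \<in> fibre B y" by (auto simp: fibre_def)
    define b where "b = (1 - \<alpha>) *\<^sub>R \<tau> (F x) - \<tau> (V (proj B g) g)"
    \<comment> \<open>The fibre element (1 - \<alpha>) F(x) - V g, built through its coordinate b,
      so that the equation for d becomes \<open>?A d = w\<close>.\<close>
    define w where "w = inv_into (fibre B y) \<tau> b"
    have w: "w \<in> fibre B y" "\<tau> w = b"
      using bij unfolding w_def bij_betw_def by (auto simp: inv_into_into f_inv_into_f)
    let ?P = "\<lambda>d. vsub B (vadd B (Q (F x) (DF d)) (V (proj B g) g)) (vscale B (1 - \<alpha>) (F x))
          = vzero B y"
    \<comment> \<open>The bundle operations are governed by their effect under
      \<open>\<tau>\<close>. The equation is therefore moved to the model space and back, by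
      injectivity of \<open>\<tau>\<close> on the fibre.\<close>
    have P: "?P d \<longleftrightarrow> ?A d = w" if d: "d \<in> ?TX" for d
    proof -
      let ?l = "vsub B (vadd B (Q (F x) (DF d)) (V (proj B g) g)) (vscale B (1 - \<alpha>) (F x))"
      have Ad: "Q (F x) (DF d) \<in> fibre B y" using AW d by auto
      have l: "?l \<in> fibre B y" "\<tau> ?l = \<tau> (?A d) - b"
        using Ad Vg Fx by (simp_all add: vsub_def add scale b_def scaleR_left_diff_distrib)
      have inj: "inj_on \<tau> (fibre B y)" using bij bij_betw_def by blast
      have "?P d \<longleftrightarrow> \<tau> ?l = 0" using inj_on_eq_iff[OF inj l(1) zero(1)] zero(2) by simp
      also have "\<dots> \<longleftrightarrow> \<tau> (?A d) = \<tau> w" using l(2) w(2) by simp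
      also have "\<dots> \<longleftrightarrow> ?A d = w" using inj_on_eq_iff[OF inj, of "?A d" w] Ad w(1) by simp
      finally show ?thesis .
    qed
    \<comment> \<open>Existence rests on A' being a right inverse of ?A, uniqueness on its being a
      left inverse.\<close>
    have "(THE d. d \<in> ?TX \<and> ?P d) = A' w"
    proof (rule the_equality)
      show "A' w \<in> ?TX \<and> ?P (A' w)" using P[OF A'W[OF w(1)]] A'W[OF w(1)] A'(2)[OF w(1)] by blast
      show "d = A' w" if d: "d \<in> ?TX \<and> ?P d" for d
      proof -
        have "?A d = w" using P[OF conjunct1[OF d]] conjunct2[OF d] by (rule iffD1)
        then show ?thesis using A'(1)[OF conjunct1[OF d]] by simp
      qed
    qed
    then have "simplified_newton_direction \<X> B Q V R F x DF \<delta> \<alpha> = A' w"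
      unfolding simplified_newton_direction_def Let_def g_def y by simp
    then show ?thesis
      using A'W[OF w(1)] K(2)[OF w(1)] w(2) by (simp add: b_def g_def transport_map_def)
  qed
  with K(1) that show thesis by blast
qed

text \<open>Here \<open>\<theta>\<close> is an arbitrary real function: the geometry enters only
  through acceptance of all small steps. If every step were rejected, the step sizes would be
  dominated by a geometric sequence and fall below \<open>\<alpha>'\<close>.\<close>

lemma backtracking_terminates:
  assumes small: "\<alpha>' > 0" "\<And>\<alpha>. 0 < \<alpha> \<Longrightarrow> \<alpha> \<le> 1 \<Longrightarrow> \<alpha> \<le> \<alpha>' \<Longrightarrow> \<theta> \<alpha> \<le> acc"
    and des: "0 < des" "des < acc"
    and a: "0 < a 0" "a 0 \<le> 1" "backtracking_run \<theta> des acc a"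
  shows "\<exists>j. \<theta> (a j) \<le> acc"
proof (rule ccontr)
  assume "\<not> ?thesis"
  then have rej: "\<theta> (a j) > acc" for j by (simp add: not_le)
  let ?r = "des / acc"
  have r: "0 \<le> ?r" "?r < 1" using des by auto
  \<comment> \<open>A run obeys the recursion at j only if all steps up to j were rejected, which
    the assumption for contradiction grants for every j.\<close>
  have step: "a (Suc j) = min 1 (a j * des / \<theta> (a j))" for j
    using a(3) rej unfolding backtracking_run_def by (meson not_le)
  have decay: "0 < a j \<and> a j \<le> 1 \<and> a j \<le> ?r ^ j" for j
  proof (induction j)
    case 0
    then show ?case using a by simp
  next
    case (Suc j)
    have th: "\<theta> (a j) > 0" using rej[of j] des by linarith
    have "a j * des / \<theta> (a j) \<le> a j * des / acc"
      using Suc rej[of j] des by (intro divide_left_mono) (auto intro!: mult_nonneg_nonneg mult_pos_pos)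
    also have "\<dots> = a j * ?r" by simp
    also have "\<dots> \<le> ?r ^ j * ?r" using Suc r by (intro mult_right_mono) auto
    finally show ?case using step[of j] Suc des th by (auto simp: mult.commute)
  qed
  have "(\<lambda>j. ?r ^ j) \<longlonglongrightarrow> 0" using r by (intro LIMSEQ_power_zero) auto
  then have "\<forall>\<^sub>F j in sequentially. ?r ^ j < \<alpha>'" using small(1) by (rule order_tendstoD)
  then obtain j where "?r ^ j < \<alpha>'" using eventually_happens by force
  then show False using small(2)[of "a j"] decay[of j] rej[of j] by linarith
qed

section \<open>Decay of \<open>\<theta>\<close> and termination of the damping loop\<close>

theorem proposition6p3:
  fixes \<X> :: "('x::topological_space, 'b::banach) chart set"
    and \<Y> :: "('y::topological_space, 'm::banach) chart set"
    and \<E> :: "('e::topological_space, 'g::banach) chart set"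
    and B :: "('e, 'y, 'f::banach) vbundle"
    and N :: "'x \<Rightarrow> ('x, 'b) tvec \<Rightarrow> real"
    and Q :: "'e \<Rightarrow> ('e, 'g) tvec \<Rightarrow> 'e"
    and V :: "'y \<Rightarrow> 'y \<Rightarrow> 'e \<Rightarrow> 'e"
    and R :: "'x \<Rightarrow> ('x, 'b) tvec \<Rightarrow> 'x"
    and F :: "'x \<Rightarrow> 'e"
    and x :: 'x
    and DF :: "('x, 'b) tvec \<Rightarrow> ('e, 'g) tvec"
    and \<delta>x :: "('x, 'b) tvec"
    and \<Theta>\<^sub>d\<^sub>e\<^sub>s \<Theta>\<^sub>a\<^sub>c\<^sub>c :: real
  defines "y \<equiv> proj B (F x)"
  defines "\<theta> \<equiv> damping_theta \<X> N B Q (V y) R F x DF \<delta>x"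
  assumes "C1_manifold \<X>"
    and "tangent_norms \<X> N"
    and "C1_vector_bundle \<E> \<Y> B"
    and "connection_map \<E> B Q"
    and "C1_retraction \<X> R"
    and "has_strict_derivative \<X> \<E> F x DF"
    and "vector_back_transport \<Y> B y (V y)"
    and "consistent_at \<E> B (V y) Q (F x)"
    and "cont_invertible (tangent_space \<X> x) (tangent_coords \<X> x)
           (fibre B y) (fibre_coords B y) (Q (F x) \<circ> DF)"
    and "newton_direction \<X> B Q F x DF \<delta>x"
    and "\<delta>x \<noteq> 0"
    and "0 < \<Theta>\<^sub>d\<^sub>e\<^sub>s" and "\<Theta>\<^sub>d\<^sub>e\<^sub>s < \<Theta>\<^sub>a\<^sub>c\<^sub>c"
  shows "(\<exists>\<alpha>'>0. \<forall>\<alpha>. 0 < \<alpha> \<and> \<alpha> \<le> 1 \<and> \<alpha> \<le> \<alpha>' \<longrightarrow> \<theta> \<alpha> \<le> \<Theta>\<^sub>a\<^sub>c\<^sub>c) \<and>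
         (\<forall>a. 0 < a 0 \<and> a 0 \<le> 1 \<and> backtracking_run \<theta> \<Theta>\<^sub>d\<^sub>e\<^sub>s \<Theta>\<^sub>a\<^sub>c\<^sub>c a \<longrightarrow> (\<exists>j. \<theta> (a j) \<le> \<Theta>\<^sub>a\<^sub>c\<^sub>c))"
proof -
  have E: "C1_manifold \<E>" using assms(5) by (simp add: C1_vector_bundle_def)
  \<comment> \<open>One chart at x and one trivialization over y suffice, since \<open>N x\<close>
    is equivalent to the norm of the coordinate in that chart.\<close>
  obtain U \<phi> where U: "(U, \<phi>) \<in> charts_at \<X> x" using charts_at_nonempty[OF assms(3)] .
  have "y \<in> (\<Union>t\<in>trivs B. fst t)" using assms(5) by (simp add: C1_vector_bundle_def)
  then obtain T \<tau> where T: "(T, \<tau>) \<in> trivs B" "y \<in> T" by auto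
  then have \<tau>: "\<tau> \<in> fibre_coords B y" by (auto simp: fibre_coords_def)
  have coord: "(\<lambda>v. v (U, \<phi>)) \<in> tangent_coords \<X> x" using U by (auto simp: tangent_coords_def)
  have \<delta>: "\<delta>x \<in> tangent_space \<X> x" using assms(12) by (simp add: newton_direction_def)
  define h where "h = (\<lambda>t. \<tau> (transport_map B (V y) (F (R x (t *\<^sub>R \<delta>x)))))"
  \<comment> \<open>This combines R x 0 = x with \<open>V y\<close> being the identity on the fibre
    over y.\<close>
  have h0: "h 0 = \<tau> (F x)"
    using assms(7,9) unfolding h_def C1_retraction_def vector_back_transport_def
    by (simp add: transport_map_def fibre_def y_def)
  have newton: "\<tau> (Q (F x) (DF \<delta>x)) = - \<tau> (F x)"
  proof -
    have "\<tau> (vadd B (Q (F x) (DF \<delta>x)) (F x)) = 0"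
      using assms(5,12) T unfolding C1_vector_bundle_def newton_direction_def y_def by fastforce
    moreover have "\<tau> (vadd B (Q (F x) (DF \<delta>x)) (F x)) = \<tau> (Q (F x) (DF \<delta>x)) + \<tau> (F x)"
    proof -
      have "Q (F x) (DF \<delta>x) \<in> fibre B y" "F x \<in> fibre B y"
        using assms(11) \<delta> unfolding cont_invertible_def cont_linear_def
        by (auto simp: fibre_def y_def)
      then show ?thesis using assms(5) T unfolding C1_vector_bundle_def by fast
    qed
    ultimately show ?thesis by (simp add: eq_neg_iff_add_eq_0)
  qed
  \<comment> \<open>The remainder in coordinates. Its derivative at 0 is - \<tau> (F x) + \<tau> (F
    x) = 0 and its value there is 0, so it is o(t).\<close>
  define \<rho> where "\<rho> t = (1 - t) *\<^sub>R \<tau> (F x) - h t" for t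
  have "(h has_vector_derivative - \<tau> (F x)) (at 0)"
    using transported_residual_derivative[OF assms(3) E assms(7,8,10) _ \<delta>] \<tau> newton
    unfolding h_def y_def by metis
  then have "(\<rho> has_vector_derivative 0) (at 0)"
    unfolding \<rho>_def by (auto intro!: derivative_eq_intros)
  moreover have "\<rho> 0 = 0" by (simp add: \<rho>_def h0)
  ultimately have \<rho>: "((\<lambda>t. norm (\<rho> t) / \<bar>t\<bar>) \<longlongrightarrow> 0) (at 0)"
    by (simp add: has_vector_derivative_def has_derivative_at)
  obtain K where K: "bounded_linear K" and
    K_eq: "\<And>\<alpha>. let d = simplified_newton_direction \<X> B Q (V y) R F x DF \<delta>x \<alpha> in
         d \<in> tangent_space \<X> x \<and> d (U, \<phi>) = K (\<rho> \<alpha>)"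
    using simplified_newton_direction_coord[where F=F and Q=Q and DF=DF and x=x, OF assms(5,9) meta_eq_to_obj_eq[OF y_def] assms(11) coord \<tau>]
    unfolding \<rho>_def h_def by blast
  obtain C where C: "C > 0" "\<And>v. norm (K v) \<le> norm v * C"
    using bounded_linear.pos_bounded[OF K] by blast
  obtain m M where mM: "m > 0" "M > 0"
    "\<And>v. v \<in> tangent_space \<X> x \<Longrightarrow> m * norm (v (U, \<phi>)) \<le> N x v \<and> N x v \<le> M * norm (v (U, \<phi>))"
    using assms(4) coord unfolding tangent_norms_def by meson
  have homog: "N x (r *\<^sub>R \<delta>x) = \<bar>r\<bar> * N x \<delta>x" for r
    using assms(4) \<delta> unfolding tangent_norms_def by blast
  \<comment> \<open>Nonnegativity is not part of \<open>tangent_norms\<close>; it follows from the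
    lower bound with m. The upper bound with M serves the estimate of
    \<open>\<theta>\<close>.\<close>
  have "N x \<delta>x \<noteq> 0" using assms(4,13) \<delta> unfolding tangent_norms_def by blast
  moreover have "0 \<le> m * norm (\<delta>x (U, \<phi>))" using mM(1) by simp
  ultimately have pos: "N x \<delta>x > 0" using mM(3)[OF \<delta>] by linarith
  \<comment> \<open>No sign condition on \<open>\<alpha>\<close> is needed: at 0 both sides are 0 by
    the convention for division by zero.\<close>
  have bound: "\<theta> \<alpha> \<le> M * C / N x \<delta>x * (norm (\<rho> \<alpha>) / \<bar>\<alpha>\<bar>)" for \<alpha>
  proof -
    let ?d = "simplified_newton_direction \<X> B Q (V y) R F x DF \<delta>x \<alpha>"
    have "N x ?d \<le> M * norm (K (\<rho> \<alpha>))" using K_eq[of \<alpha>] mM(3)[of ?d] by (simp add: Let_def)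
    also have "\<dots> \<le> M * (norm (\<rho> \<alpha>) * C)" using C(2)[of "\<rho> \<alpha>"] mM(2) by simp
    finally have "N x ?d / (\<bar>\<alpha>\<bar> * N x \<delta>x) \<le> M * (norm (\<rho> \<alpha>) * C) / (\<bar>\<alpha>\<bar> * N x \<delta>x)"
      using pos by (intro divide_right_mono) auto
    then show ?thesis unfolding \<theta>_def damping_theta_def homog by (simp add: mult_ac)
  qed
  have "((\<lambda>\<alpha>. M * C / N x \<delta>x * (norm (\<rho> \<alpha>) / \<bar>\<alpha>\<bar>)) \<longlongrightarrow> M * C / N x \<delta>x * 0) (at 0)"
    by (intro tendsto_mult_left \<rho>)
  moreover have "M * C / N x \<delta>x * 0 < \<Theta>\<^sub>a\<^sub>c\<^sub>c" using assms(14,15) by simp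
  ultimately have "\<forall>\<^sub>F \<alpha> in at 0. M * C / N x \<delta>x * (norm (\<rho> \<alpha>) / \<bar>\<alpha>\<bar>) < \<Theta>\<^sub>a\<^sub>c\<^sub>c"
    by (rule order_tendstoD)
  then obtain d where d: "d > 0" and
    small: "\<And>\<alpha>. \<alpha> \<noteq> 0 \<Longrightarrow> dist \<alpha> 0 < d \<Longrightarrow> M * C / N x \<delta>x * (norm (\<rho> \<alpha>) / \<bar>\<alpha>\<bar>) < \<Theta>\<^sub>a\<^sub>c\<^sub>c"
    unfolding eventually_at by blast
  \<comment> \<open>Halving d turns the strict inequality dist \<alpha> 0 < d into the non-strict
    bound \<alpha> \<le> d / 2.\<close>
  have accept: "\<theta> \<alpha> \<le> \<Theta>\<^sub>a\<^sub>c\<^sub>c" if "0 < \<alpha>" "\<alpha> \<le> 1" "\<alpha> \<le> d / 2" for \<alpha>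
    using small[of \<alpha>] bound[of \<alpha>] that d by (simp add: dist_real_def)
  moreover have d2: "d / 2 > 0" using d by simp
  moreover have "\<exists>j. \<theta> (a j) \<le> \<Theta>\<^sub>a\<^sub>c\<^sub>c"
    if "0 < a 0" "a 0 \<le> 1" "backtracking_run \<theta> \<Theta>\<^sub>d\<^sub>e\<^sub>s \<Theta>\<^sub>a\<^sub>c\<^sub>c a" for a
    using d2 accept assms(14,15) that by (rule backtracking_terminates)
  ultimately show ?thesis by blast
qed

end
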